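(* Let $L\phi=\phi'''$ with $\operatorname{Dom}L=\{\phi\in\mathcal S[0,\infty):\phi'(0)=0\}$, and let $F,F^{-1}$ be the transforms defined in the context. There exists a remainder transform $R$ (assigning to each $\phi\in\operatorname{Dom}L$ a function $R[\phi]$ on $\mathbb R\cup\partial D^+$) for which, for all $\lambda\in\mathbb R\cup\partial D^+$ and all $\phi\in\operatorname{Dom}L$, $$F[L\phi](\lambda)=-i\lambda^3F[\phi](\lambda)+R[\phi](\lambda).$$ Moreover, if $q:[0,\infty)\times[0,T]\to\mathbb C$ is sufficiently smooth in the sense given in the context and, for all $t\in[0,T]$, $q(\cdot,t)\in\operatorname{Dom}L$, then, for all $t\in[0,T]$ and all $x\in(0,\infty)$, $$F^{-1}\left[\lambda\mapsto\int_0^t e^{-i\lambda^3(s-t)}R[q](\lambda;s)\,ds\right](x)=0,$$ where $R[q](\lambda;s)=R[q(\cdot,s)](\lambda)$.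
   Context: $T>0$. $\mathcal S[0,\infty)$ is the space of (complex valued) smooth functions on $[0,\infty)$ (smooth up to $0$) which decay rapidly at infinity along with all of their derivatives. Let $\alpha=e^{2\pi i/3}$. $D^+=\{\lambda\in\mathbb C\setminus\{0\}:\arg\lambda\in(\pi/3,2\pi/3)\}$, and $\partial D^+$ is its boundary contour, positively oriented ($D^+$ lies to the left): it comes from $\infty$ along the ray $\arg\lambda=2\pi/3$ to $0$ and goes out to $\infty$ along the ray $\arg\lambda=\pi/3$. The contour $\mathbb R$ is oriented in the increasing sense. For $\phi\in\mathcal S[0,\infty)$, the transform $F[\phi]$ is the function on $\mathbb R\cup\partial D^+$ with one formula on each contour: $$F[\phi](\lambda)=\begin{cases}\int_0^\infty e^{-i\lambda y}\phi(y)\,dy & \lambda\in\mathbb R,\\[2pt] \int_0^\infty \phi(y)\left[\alpha^2 e^{-i\alpha\lambda y}+\alpha e^{-i\alpha^2\lambda y}\right]dy & \lambda\in\partial D^+.\end{cases}$$ (The two contours meet only at $0$; a function on $\mathbb R\cup\partial D^+$ means a pair consisting of a function on $\mathbb R$ and a function on $\partial D^+$, and identities "for all $\lambda\in\mathbb R\cup\partial D^+$" are meant on each contour separately.) The inverse transform is $$F^{-1}[f](x)=\frac1{2\pi}\int_{\mathbb R\cup\partial D^+}e^{i\lambda x}f(\lambda)\,d\lambda=\frac1{2\pi}\int_{\mathbb R}e^{i\lambda x}f(\lambda)\,d\lambda+\frac1{2\pi}\int_{\partial D^+}e^{i\lambda x}f(\lambda)\,d\lambda,$$ where each integral over an unbounded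 contour is improper, understood as the limit as $N\to\infty$ of the integral over the part of the contour with $|\lambda|\leq N$. "$q$ sufficiently smooth" means: for $j=0,1,2$ the partial derivatives $\partial_x^jq$ and $\partial_t\partial_x^jq$ exist and are continuous on $[0,\infty)\times[0,T]$. *)

theory Defs
  imports "HOL-Complex_Analysis.Complex_Analysis"
begin

(* Functions on [0,\<infinity>) are total functions whose values on negative reals are irrelevant:
   every derivative is taken within {0..}, hence is one-sided at 0. *)
definition deriv_hl :: "(real \<Rightarrow> complex) \<Rightarrow> real \<Rightarrow> complex" where
  "deriv_hl \<phi> x = vector_derivative \<phi> (at x within {0..})"

definition schwartz_hl :: "(real \<Rightarrow> complex) set" where
  "schwartz_hl = {\<phi>.
     (\<forall>n. \<forall>x\<ge>0. (deriv_hl ^^ n) \<phi> differentiable (at x within {0..})) \<and>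
     (\<forall>n m. \<exists>C. \<forall>x\<ge>0. x ^ m * norm ((deriv_hl ^^ n) \<phi> x) \<le> C)}"

definition L_op :: "(real \<Rightarrow> complex) \<Rightarrow> real \<Rightarrow> complex" where
  "L_op \<phi> = (deriv_hl ^^ 3) \<phi>"

definition Dom_L :: "(real \<Rightarrow> complex) set" where
  "Dom_L = {\<phi> \<in> schwartz_hl. deriv_hl \<phi> 0 = 0}"

definition Dplus :: "complex set" where
  "Dplus = {z. z \<noteq> 0 \<and> pi / 3 < Arg z \<and> Arg z < 2 * pi / 3}"

(* The real line and the boundary of Dplus share the point 0, where a function may have two
   different values. The contours are therefore combined as a disjoint union, so that a
   function on contour_point amounts to a pair of functions, one on each contour. *)
datatype contour_point = On_R real | On_D complex

primrec pt :: "contour_point \<Rightarrow> complex" where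
  "pt (On_R r) = of_real r"
| "pt (On_D z) = z"

definition contours :: "contour_point set" where
  "contours = range On_R \<union> On_D ` frontier Dplus"

definition alpha :: complex where
  "alpha = exp (2 * of_real pi * \<i> / 3)"

primrec F :: "(real \<Rightarrow> complex) \<Rightarrow> contour_point \<Rightarrow> complex" where
  "F \<phi> (On_R r) = integral {0..} (\<lambda>y. exp (- \<i> * of_real r * of_real y) * \<phi> y)"
| "F \<phi> (On_D z) = integral {0..} (\<lambda>y. \<phi> y *
     (alpha\<^sup>2 * exp (- \<i> * alpha * z * of_real y) + alpha * exp (- \<i> * alpha\<^sup>2 * z * of_real y)))"

(* The part of the boundary of Dplus in the disc of radius N, with Dplus on its left. *)
definition bdry_path :: "real \<Rightarrow> real \<Rightarrow> complex" where
  "bdry_path N = linepath (of_real N * cis (2 * pi / 3)) 0 +++ linepath 0 (of_real N * cis (pi / 3))"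

(* Both improper integrals are required to converge separately, and the inverse transform of f
   at x has the value v. *)
definition has_F_inv :: "(contour_point \<Rightarrow> complex) \<Rightarrow> real \<Rightarrow> complex \<Rightarrow> bool" where
  "has_F_inv f x v \<longleftrightarrow> (\<exists>I J.
     (\<forall>N>0. (\<lambda>r. exp (\<i> * of_real r * of_real x) * f (On_R r)) integrable_on {-N..N}) \<and>
     ((\<lambda>N. integral {-N..N} (\<lambda>r. exp (\<i> * of_real r * of_real x) * f (On_R r))) \<longlongrightarrow> I) at_top \<and>
     (\<forall>N>0. (\<lambda>z. exp (\<i> * z * of_real x) * f (On_D z)) contour_integrable_on bdry_path N) \<and>
     ((\<lambda>N. contour_integral (bdry_path N) (\<lambda>z. exp (\<i> * z * of_real x) * f (On_D z))) \<longlongrightarrow> J) at_top \<and>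
     v = 1 / (2 * of_real pi) * I + 1 / (2 * of_real pi) * J)"

definition partial_x :: "nat \<Rightarrow> (real \<Rightarrow> real \<Rightarrow> complex) \<Rightarrow> real \<Rightarrow> real \<Rightarrow> complex" where
  "partial_x j q x t = (deriv_hl ^^ j) (\<lambda>y. q y t) x"

definition sufficiently_smooth :: "real \<Rightarrow> (real \<Rightarrow> real \<Rightarrow> complex) \<Rightarrow> bool" where
  "sufficiently_smooth T q \<longleftrightarrow>
     (\<forall>j<2. \<forall>x\<ge>0. \<forall>t\<in>{0..T}. (\<lambda>y. partial_x j q y t) differentiable (at x within {0..})) \<and>
     (\<forall>j\<le>2. continuous_on ({0..} \<times> {0..T}) (\<lambda>(x, t). partial_x j q x t)) \<and>
     (\<forall>j\<le>2. \<forall>x\<ge>0. \<forall>t\<in>{0..T}. (\<lambda>s. partial_x j q x s) differentiable (at t within {0..T})) \<and>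
     (\<forall>j\<le>2. continuous_on ({0..} \<times> {0..T})
        (\<lambda>(x, t). vector_derivative (\<lambda>s. partial_x j q x s) (at t within {0..T})))"

end

theory Submission imports Defs begin

text \<open>
  Three integrations by parts on the half line give, whenever \<open>Im \<mu> \<le> 0\<close> and \<open>\<phi>'(0) = 0\<close>,
  that \<open>\<integral> e\<^sup>-\<^sup>i\<^sup>\<mu>\<^sup>y \<phi>''' dy = - i \<mu>\<^sup>3 \<integral> e\<^sup>-\<^sup>i\<^sup>\<mu>\<^sup>y \<phi> dy + (\<mu>\<^sup>2 \<phi>(0) - \<phi>''(0))\<close>. On the real line
  \<open>\<mu> = \<lambda>\<close>, and the remainder is the polynomial \<open>\<lambda>\<^sup>2 \<phi>(0) - \<phi>''(0)\<close>. On the boundary of the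
  sector \<open>\<mu>\<close> is \<open>\<alpha>\<lambda>\<close> or \<open>\<alpha>\<^sup>2\<lambda>\<close>; both cubes equal \<open>\<lambda>\<^sup>3\<close>, and since \<open>\<alpha>\<^sup>2 + \<alpha> = -1\<close> the weights
  \<open>\<alpha>\<^sup>2\<close> and \<open>\<alpha>\<close> combine the two boundary terms into exactly the negative of that polynomial.

  Therefore the function to be inverted is \<open>g\<close> on the line and \<open>- g\<close> on the sector boundary, for
  the single function \<open>g(\<lambda>) = \<integral>\<^sub>0\<^sup>t e\<^sup>i\<^sup>\<lambda>\<^sup>3\<^sup>(\<^sup>t\<^sup>-\<^sup>s\<^sup>) (\<lambda>\<^sup>2 q(0,s) - q\<^sub>x\<^sub>x(0,s)) ds\<close>, which is entire. It
  remains to see that \<open>e\<^sup>i\<^sup>\<lambda>\<^sup>x g(\<lambda>)\<close> has the same, convergent, integral over both contours.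
  Between the contours \<open>Im \<lambda>\<^sup>3 \<ge> 0\<close>, so the exponential in \<open>g\<close> is bounded by 1; one integration by parts
  in \<open>s\<close>, which uses that the boundary values are continuously differentiable in time, gains
  \<open>\<lambda>\<^sup>-\<^sup>3\<close> and shows \<open>g(\<lambda>) = O(1/|\<lambda>|)\<close> there (\<open>time_integral_decay\<close>).
  For \<open>x > 0\<close> the factor \<open>e\<^sup>i\<^sup>\<lambda>\<^sup>x\<close> decays in the upper half plane. As in Jordan's lemma, the two
  paths that join the endpoints of the truncated contours then contribute \<open>O(1/N)\<close>, while the integral
  over the rays converges absolutely; the integral over the line has to converge to the same limit
  (\<open>real_line_and_sector_boundary_integrals\<close>).
\<close>

section \<open>Improper integrals on the half line\<close>

text \<open>
  With \<open>G\<close> tending to zero this evaluates an integral over the half line; with \<open>G\<close> unknown at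
  infinity it yields the existence of the limit. Both uses occur below.
\<close>
lemma half_line_FTC:
  fixes G g :: "real \<Rightarrow> complex"
  assumes der: "\<And>x. x \<ge> 0 \<Longrightarrow> (G has_vector_derivative g x) (at x within {0..})"
    and g: "g absolutely_integrable_on {0..}"
  shows "(G \<longlongrightarrow> G 0 + integral {0..} g) at_top"
proof -
  have "((\<lambda>N. LINT x:{0..N}|lebesgue. g x) \<longlongrightarrow> (LINT x:{0..}|lebesgue. g x)) at_top"
    by (rule tendsto_set_lebesgue_integral_at_top) (use g in auto)
  then have "((\<lambda>N. LINT x:{0..N}|lebesgue. g x) \<longlongrightarrow> integral {0..} g) at_top"
    using set_lebesgue_integral_eq_integral(2)[OF g] by simp
  moreover have "\<forall>\<^sub>F N in at_top. (LINT x:{0..N}|lebesgue. g x) = G N - G 0"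
    using eventually_ge_at_top[of 0]
  proof eventually_elim
    case (elim N)
    have "g absolutely_integrable_on {0..N}"
      by (rule set_integrable_subset[OF g]) auto
    then have "(LINT x:{0..N}|lebesgue. g x) = integral {0..N} g"
      by (rule set_lebesgue_integral_eq_integral(2))
    also have "(g has_integral G N - G 0) {0..N}"
      by (rule fundamental_theorem_of_calculus[OF elim])
         (auto intro: has_vector_derivative_within_subset[OF der])
    then have "integral {0..N} g = G N - G 0" by (rule integral_unique)
    finally show ?case .
  qed
  ultimately have "((\<lambda>N. G N - G 0) \<longlongrightarrow> integral {0..} g) at_top"
    using tendsto_cong by fast
  from tendsto_add[OF tendsto_const[of "G 0"] this] show ?thesis by simp
qed

lemma absolutely_integrable_half_line_bound:
  fixes g :: "real \<Rightarrow> complex"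
  assumes "continuous_on {0..} g" and "k integrable_on {0..}"
    and "\<And>x. x \<ge> 0 \<Longrightarrow> norm (g x) \<le> k x"
  shows "g absolutely_integrable_on {0..}"
  by (rule measurable_bounded_by_integrable_imp_absolutely_integrable[where g = k])
     (use assms in \<open>auto intro!: continuous_imp_measurable_on_sets_lebesgue\<close>)

text \<open>The integrable majorant for rapidly decaying functions.\<close>
lemma integrable_inverse_one_plus_square: "(\<lambda>x::real. 1 / (1 + x\<^sup>2)) integrable_on {0..}"
proof -
  have nz: "1 + x\<^sup>2 \<noteq> 0" for x :: real
    by (smt (verit) zero_le_power2)
  have "integral {0..y} (\<lambda>x::real. 1 / (1 + x\<^sup>2)) = arctan y" if "y \<ge> 0" for y
  proof (rule integral_unique)
    have "((\<lambda>x::real. 1 / (1 + x\<^sup>2)) has_integral (arctan y - arctan 0)) {0..y}"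
      by (rule fundamental_theorem_of_calculus[OF that])
         (auto intro!: derivative_eq_intros simp: field_simps
           simp flip: has_real_derivative_iff_has_vector_derivative)
    then show "((\<lambda>x::real. 1 / (1 + x\<^sup>2)) has_integral arctan y) {0..y}" by simp
  qed
  then have "\<forall>\<^sub>F y in at_top. integral {0..y} (\<lambda>x::real. 1 / (1 + x\<^sup>2)) = arctan y"
    by (intro eventually_mono[OF eventually_ge_at_top[of 0]])
  then have "((\<lambda>y. integral {0..y} (\<lambda>x::real. 1 / (1 + x\<^sup>2))) \<longlongrightarrow> pi/2) at_top"
    using tendsto_arctan_at_top tendsto_cong by fast
  then have "((\<lambda>x::real. 1 / (1 + x\<^sup>2)) has_integral (pi/2)) {0..}"
    by (intro has_integral_to_inf integrable_continuous_interval continuous_intros)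
       (use nz in auto)
  then show ?thesis by blast
qed

section \<open>The remainder on each contour\<close>

lemma schwartz_hl_has_derivative:
  assumes "\<phi> \<in> schwartz_hl" "x \<ge> 0"
  shows "((deriv_hl ^^ n) \<phi> has_vector_derivative (deriv_hl ^^ Suc n) \<phi> x) (at x within {0..})"
  using assms by (simp add: schwartz_hl_def deriv_hl_def vector_derivative_works)

lemma schwartz_hl_bound:
  assumes "\<phi> \<in> schwartz_hl"
  obtains C where "\<And>x. x \<ge> 0 \<Longrightarrow> norm ((deriv_hl ^^ n) \<phi> x) \<le> C * (1 / (1 + x\<^sup>2))"
proof -
  obtain A where A: "\<And>x. x \<ge> 0 \<Longrightarrow> x ^ 0 * norm ((deriv_hl ^^ n) \<phi> x) \<le> A"
    using assms unfolding schwartz_hl_def by blast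
  obtain B where B: "\<And>x. x \<ge> 0 \<Longrightarrow> x ^ 2 * norm ((deriv_hl ^^ n) \<phi> x) \<le> B"
    using assms unfolding schwartz_hl_def by blast
  show ?thesis
  proof (rule that[of "A + B"])
    fix x :: real assume x: "x \<ge> 0"
    have pos: "1 + x\<^sup>2 > 0" by (smt (verit) zero_le_power2)
    have "norm ((deriv_hl ^^ n) \<phi> x) * (1 + x\<^sup>2) \<le> A + B"
      using A[OF x] B[OF x] by (simp add: algebra_simps)
    then show "norm ((deriv_hl ^^ n) \<phi> x) \<le> (A + B) * (1 / (1 + x\<^sup>2))"
      using pos by (simp add: pos_le_divide_eq)
  qed
qed

lemma norm_exp_lower_half_plane:
  assumes "Im \<mu> \<le> 0" "y \<ge> 0"
  shows "norm (exp (- \<i> * \<mu> * of_real y)) \<le> 1"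
  using assms by (simp add: mult_nonpos_nonneg)

lemma schwartz_hl_transform_integrable:
  assumes "\<phi> \<in> schwartz_hl" "Im \<mu> \<le> 0"
  shows "(\<lambda>y. exp (- \<i> * \<mu> * of_real y) * (deriv_hl ^^ n) \<phi> y) absolutely_integrable_on {0..}"
proof -
  obtain C where C: "\<And>x. x \<ge> 0 \<Longrightarrow> norm ((deriv_hl ^^ n) \<phi> x) \<le> C * (1 / (1 + x\<^sup>2))"
    using schwartz_hl_bound[OF assms(1)] by blast
  have "continuous_on {0..} ((deriv_hl ^^ n) \<phi>)"
    using schwartz_hl_has_derivative[OF assms(1)]
    by (intro continuous_on_vector_derivative) auto
  then show ?thesis
  proof (intro absolutely_integrable_half_line_bound continuous_intros)
    show "(\<lambda>x. C * (1 / (1 + x\<^sup>2))) integrable_on {0..}"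
      by (rule integrable_on_mult_right[OF integrable_inverse_one_plus_square])
  next
    fix x :: real assume x: "x \<ge> 0"
    have "norm (exp (- \<i> * \<mu> * of_real x)) * norm ((deriv_hl ^^ n) \<phi> x) \<le> 1 * (C * (1 / (1 + x\<^sup>2)))"
      by (intro mult_mono norm_exp_lower_half_plane C x assms) auto
    then show "norm (exp (- \<i> * \<mu> * of_real x) * (deriv_hl ^^ n) \<phi> x) \<le> C * (1 / (1 + x\<^sup>2))"
      by (simp add: norm_mult)
  qed
qed

lemma schwartz_hl_tendsto_0:
  assumes "\<phi> \<in> schwartz_hl"
  shows "((deriv_hl ^^ n) \<phi> \<longlongrightarrow> 0) at_top"
proof -
  obtain C where C: "\<And>x. x \<ge> 0 \<Longrightarrow> norm ((deriv_hl ^^ n) \<phi> x) \<le> C * (1 / (1 + x\<^sup>2))"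
    using schwartz_hl_bound[OF assms] by blast
  show ?thesis
  proof (rule Lim_null_comparison)
    show "\<forall>\<^sub>F x in at_top. norm ((deriv_hl ^^ n) \<phi> x) \<le> C * (1 / (1 + x\<^sup>2))"
      using eventually_ge_at_top[of 0] by eventually_elim (rule C)
    show "((\<lambda>x::real. C * (1 / (1 + x\<^sup>2))) \<longlongrightarrow> 0) at_top"
      by (intro tendsto_mult_right_zero tendsto_divide_0[OF tendsto_const]
          filterlim_at_top_imp_at_infinity filterlim_tendsto_add_at_top[OF tendsto_const]
          filterlim_pow_at_top filterlim_ident) auto
  qed
qed

text \<open>
  The function \<open>G\<close> in the proof collects the boundary terms of all three integrations by parts, so that
  \<open>half_line_FTC\<close> needs to be applied only once. The condition on \<open>\<mu>\<close> keeps the exponential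
  bounded; the boundary condition removes the term with \<open>\<phi>'(0)\<close>.
\<close>
lemma transform_third_derivative:
  assumes \<phi>: "\<phi> \<in> Dom_L" and \<mu>: "Im \<mu> \<le> 0"
  shows "integral {0..} (\<lambda>y. exp (- \<i> * \<mu> * of_real y) * L_op \<phi> y)
       = - \<i> * \<mu> ^ 3 * integral {0..} (\<lambda>y. exp (- \<i> * \<mu> * of_real y) * \<phi> y)
         + (\<mu>\<^sup>2 * \<phi> 0 - (deriv_hl ^^ 2) \<phi> 0)"
proof -
  have sch: "\<phi> \<in> schwartz_hl" and bc: "deriv_hl \<phi> 0 = 0"
    using \<phi> by (auto simp: Dom_L_def)
  define D where "D n = (deriv_hl ^^ n) \<phi>" for n
  define E where "E y = exp (- \<i> * \<mu> * of_real y)" for y :: real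
  define G where "G y = E y * (D 2 y + \<i> * \<mu> * D 1 y + (\<i> * \<mu>)\<^sup>2 * D 0 y)" for y
  define g where "g y = E y * D 3 y + \<i> * \<mu> ^ 3 * (E y * D 0 y)" for y
  have D: "(D n has_vector_derivative D (Suc n) y) (at y within {0..})" if "y \<ge> 0" for n y
    using schwartz_hl_has_derivative[OF sch that] by (simp add: D_def)
  have E: "(E has_vector_derivative - \<i> * \<mu> * E y) (at y within {0..})" for y
  proof -
    have "((\<lambda>y. exp (- \<i> * \<mu> * y)) has_field_derivative - \<i> * \<mu> * E y) (at (of_real y))"
      by (auto intro!: derivative_eq_intros simp: E_def)
    from has_vector_derivative_real_field[OF this]
    show ?thesis unfolding E_def by (rule has_vector_derivative_at_within)
  qed
  have int: "(\<lambda>y. E y * D n y) absolutely_integrable_on {0..}" for n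
    using schwartz_hl_transform_integrable[OF sch \<mu>] by (simp add: E_def D_def)
  have "(G has_vector_derivative g y) (at y within {0..})" if "y \<ge> 0" for y
    unfolding G_def
    apply (rule has_vector_derivative_eq_rhs)
     apply (rule derivative_intros E D that)+
    apply (simp add: g_def eval_nat_numeral algebra_simps)
    done
  moreover have "g absolutely_integrable_on {0..}"
    unfolding g_def by (intro set_integral_add set_integrable_mult_right int)
  ultimately have "(G \<longlongrightarrow> G 0 + integral {0..} g) at_top"
    by (rule half_line_FTC)
  moreover have "(G \<longlongrightarrow> 0) at_top"
  proof (rule Lim_null_comparison)
    show "\<forall>\<^sub>F y in at_top. norm (G y) \<le> norm (D 2 y + \<i> * \<mu> * D 1 y + (\<i> * \<mu>)\<^sup>2 * D 0 y)"
      using eventually_ge_at_top[of 0]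
    proof eventually_elim
      case (elim y)
      show ?case using mult_right_mono[OF norm_exp_lower_half_plane[OF \<mu> elim] norm_ge_zero]
        by (simp add: G_def E_def norm_mult)
    qed
    have "(D n \<longlongrightarrow> 0) at_top" for n
      unfolding D_def by (rule schwartz_hl_tendsto_0[OF sch])
    then show "((\<lambda>y. norm (D 2 y + \<i> * \<mu> * D 1 y + (\<i> * \<mu>)\<^sup>2 * D 0 y)) \<longlongrightarrow> 0) at_top"
      by (intro tendsto_norm_zero tendsto_add_zero tendsto_mult_right_zero)
  qed
  ultimately have "G 0 + integral {0..} g = 0"
    using tendsto_unique trivial_limit_at_top_linorder by blast
  moreover have "integral {0..} g = integral {0..} (\<lambda>y. E y * D 3 y)
      + \<i> * \<mu> ^ 3 * integral {0..} (\<lambda>y. E y * D 0 y)"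
    using set_lebesgue_integral_eq_integral(1)[OF int] unfolding g_def
    by (subst integral_add) (auto intro: integrable_on_mult_right)
  moreover have "G 0 = (deriv_hl ^^ 2) \<phi> 0 - \<mu>\<^sup>2 * \<phi> 0"
    using bc by (simp add: G_def E_def D_def power_mult_distrib)
  ultimately show ?thesis
    by (simp add: L_op_def E_def D_def) (simp add: algebra_simps add_eq_0_iff)
qed

lemma alpha_eq_cis: "alpha = cis (2 * pi / 3)"
  by (simp add: alpha_def cis_conv_exp algebra_simps)

lemma alpha_cubed: "alpha ^ 3 = 1"
proof -
  have "alpha ^ 3 = cis (real 3 * (2 * pi / 3))"
    by (simp only: alpha_eq_cis Complex.DeMoivre)
  then show ?thesis by simp
qed

lemma alpha_plus_alpha_squared: "alpha\<^sup>2 + alpha = -1"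
proof -
  have "alpha \<noteq> 1"
    using sin_120 by (auto simp: alpha_eq_cis complex_eq_iff)
  moreover have "(alpha - 1) * (alpha\<^sup>2 + alpha + 1) = 0"
    using alpha_cubed by (simp add: algebra_simps eval_nat_numeral)
  ultimately have "alpha\<^sup>2 + alpha + 1 = 0" by simp
  then show ?thesis by (simp only: eq_neg_iff_add_eq_0)
qed

text \<open>
  Multiplication by \<open>\<alpha>\<close> and by \<open>\<alpha>\<^sup>2\<close> rotates the sector to the arguments \<open>(\<pi>, 4\<pi>/3)\<close> and
  \<open>(5\<pi>/3, 2\<pi>)\<close>, both in the lower half plane. These conditions are closed, so they pass from
  the sector to its frontier.
\<close>
lemma frontier_Dplus_rotated:
  assumes "z \<in> frontier Dplus"
  shows "Im (alpha * z) \<le> 0" "Im (alpha\<^sup>2 * z) \<le> 0"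
proof -
  have "Dplus \<subseteq> {z. Im (alpha * z) \<le> 0 \<and> Im (alpha\<^sup>2 * z) \<le> 0}"
  proof
    fix z assume z: "z \<in> Dplus"
    have eq: "z = of_real (norm z) * cis (Arg z)"
      using z by (simp add: Dplus_def cis_Arg sgn_div_norm field_simps scaleR_conv_of_real)
    have eq1: "alpha * z = of_real (norm z) * cis (Arg z + 2 * pi / 3)"
      by (subst eq) (simp add: alpha_eq_cis cis_mult add_ac)
    have eq2: "alpha\<^sup>2 * z = of_real (norm z) * cis (Arg z + 4 * pi / 3)"
      by (subst eq) (simp add: alpha_eq_cis power2_eq_square cis_mult add_ac)
    have sins: "sin (Arg z + 2 * pi / 3) \<le> 0" "sin (Arg z + 4 * pi / 3) \<le> 0"
      using z by (auto intro!: sin_le_zero simp: Dplus_def)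
    show "z \<in> {z. Im (alpha * z) \<le> 0 \<and> Im (alpha\<^sup>2 * z) \<le> 0}"
      unfolding mem_Collect_eq eq1 eq2 using sins by (simp add: mult_nonneg_nonpos)
  qed
  moreover have "closed {z. Im (alpha * z) \<le> 0 \<and> Im (alpha\<^sup>2 * z) \<le> 0}"
    by (intro closed_Collect_conj closed_Collect_le continuous_intros)
  ultimately have "closure Dplus \<subseteq> {z. Im (alpha * z) \<le> 0 \<and> Im (alpha\<^sup>2 * z) \<le> 0}"
    by (rule closure_minimal)
  with assms show "Im (alpha * z) \<le> 0" "Im (alpha\<^sup>2 * z) \<le> 0"
    by (auto simp: frontier_def)
qed

primrec remainder :: "(real \<Rightarrow> complex) \<Rightarrow> contour_point \<Rightarrow> complex" where
  "remainder \<phi> (On_R r) = (of_real r)\<^sup>2 * \<phi> 0 - (deriv_hl ^^ 2) \<phi> 0"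
| "remainder \<phi> (On_D z) = - (z\<^sup>2 * \<phi> 0 - (deriv_hl ^^ 2) \<phi> 0)"

text \<open>
  On the sector boundary the coefficient of \<open>z\<^sup>2 \<phi>(0)\<close> is \<open>\<alpha>\<^sup>2 \<alpha>\<^sup>2 + \<alpha> \<alpha>\<^sup>4 = \<alpha> + \<alpha>\<^sup>2\<close> and that of
  \<open>- \<phi>''(0)\<close> is \<open>\<alpha>\<^sup>2 + \<alpha>\<close>. Both are \<open>-1\<close>, whence the sign in the second clause of \<open>remainder\<close>.
\<close>
lemma F_L_op:
  assumes "l \<in> contours" and \<phi>: "\<phi> \<in> Dom_L"
  shows "F (L_op \<phi>) l = - \<i> * pt l ^ 3 * F \<phi> l + remainder \<phi> l"
proof (cases l)
  case (On_R r)
  show ?thesis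
    using transform_third_derivative[OF \<phi>, of "of_real r"] by (simp add: On_R)
next
  case (On_D z)
  with assms have z: "z \<in> frontier Dplus" by (auto simp: contours_def)
  have sch: "\<phi> \<in> schwartz_hl" using \<phi> by (simp add: Dom_L_def)
  define J where "J \<mu> \<psi> = integral {0..} (\<lambda>y. exp (- \<i> * \<mu> * of_real y) * \<psi> y)"
    for \<mu> and \<psi> :: "real \<Rightarrow> complex"
  have split: "F ((deriv_hl ^^ n) \<phi>) (On_D z)
      = alpha\<^sup>2 * J (alpha * z) ((deriv_hl ^^ n) \<phi>) + alpha * J (alpha\<^sup>2 * z) ((deriv_hl ^^ n) \<phi>)" for n
  proof -
    note int = set_lebesgue_integral_eq_integral(1)[OF schwartz_hl_transform_integrable[OF sch]]
    have "F ((deriv_hl ^^ n) \<phi>) (On_D z) = integral {0..} (\<lambda>y.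
        alpha\<^sup>2 * (exp (- \<i> * (alpha * z) * of_real y) * (deriv_hl ^^ n) \<phi> y)
        + alpha * (exp (- \<i> * (alpha\<^sup>2 * z) * of_real y) * (deriv_hl ^^ n) \<phi> y))"
      by (simp add: algebra_simps)
    also have "\<dots> = alpha\<^sup>2 * J (alpha * z) ((deriv_hl ^^ n) \<phi>)
        + alpha * J (alpha\<^sup>2 * z) ((deriv_hl ^^ n) \<phi>)"
      using int[OF frontier_Dplus_rotated(1)[OF z]] int[OF frontier_Dplus_rotated(2)[OF z]]
      unfolding J_def
      by (subst integral_add) (auto intro: integrable_on_mult_right)
    finally show ?thesis .
  qed
  have a4: "alpha ^ 4 = alpha" and a6: "alpha ^ 6 = 1"
    using alpha_cubed by (simp_all add: eval_nat_numeral algebra_simps)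
  define c where "c = (deriv_hl ^^ 2) \<phi> 0"
  have 1: "J (alpha * z) (L_op \<phi>) = - \<i> * z ^ 3 * J (alpha * z) \<phi> + (alpha\<^sup>2 * z\<^sup>2 * \<phi> 0 - c)"
    using transform_third_derivative[OF \<phi> frontier_Dplus_rotated(1)[OF z]]
    by (simp add: J_def c_def power_mult_distrib alpha_cubed)
  have 2: "J (alpha\<^sup>2 * z) (L_op \<phi>) = - \<i> * z ^ 3 * J (alpha\<^sup>2 * z) \<phi> + (alpha * z\<^sup>2 * \<phi> 0 - c)"
    using transform_third_derivative[OF \<phi> frontier_Dplus_rotated(2)[OF z]]
    by (simp add: J_def c_def power_mult_distrib alpha_cubed a4 a6 flip: power_mult)
  have "alpha\<^sup>2 * (alpha\<^sup>2 * z\<^sup>2 * \<phi> 0 - c) + alpha * (alpha * z\<^sup>2 * \<phi> 0 - c)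
      = (alpha ^ 4 + alpha\<^sup>2) * (z\<^sup>2 * \<phi> 0) - (alpha\<^sup>2 + alpha) * c"
    by (simp add: algebra_simps eval_nat_numeral)
  also have "\<dots> = - (z\<^sup>2 * \<phi> 0 - c)"
    using alpha_plus_alpha_squared by (simp add: a4 add.commute)
  finally have boundary_terms: "alpha\<^sup>2 * (alpha\<^sup>2 * z\<^sup>2 * \<phi> 0 - c) + alpha * (alpha * z\<^sup>2 * \<phi> 0 - c)
      = remainder \<phi> (On_D z)"
    by (simp add: c_def)
  have "F (L_op \<phi>) (On_D z) = alpha\<^sup>2 * J (alpha * z) (L_op \<phi>) + alpha * J (alpha\<^sup>2 * z) (L_op \<phi>)"
    unfolding L_op_def by (rule split)
  also have "\<dots> = - \<i> * z ^ 3 * (alpha\<^sup>2 * J (alpha * z) \<phi> + alpha * J (alpha\<^sup>2 * z) \<phi>)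
      + (alpha\<^sup>2 * (alpha\<^sup>2 * z\<^sup>2 * \<phi> 0 - c) + alpha * (alpha * z\<^sup>2 * \<phi> 0 - c))"
    unfolding 1 2 by (simp only: ring_distribs mult_ac add_ac)
  also have "alpha\<^sup>2 * J (alpha * z) \<phi> + alpha * J (alpha\<^sup>2 * z) \<phi> = F \<phi> (On_D z)"
    using split[of 0] by (simp only: funpow_0)
  finally show ?thesis
    by (simp only: boundary_terms On_D pt.simps)
qed

section \<open>Deforming the real line to the boundary of the sector\<close>

text \<open>
  An estimate of \<open>\<integral> h\<close> along a straight segment, phrased as an increment of a primitive, which is bounded by the
  increment of the primitive \<open>- (B / c) e\<^sup>-\<^sup>c\<^sup>r\<close> of the majorant. The bound is uniform in the length
  \<open>l\<close>; this is what replaces the arc estimate of Jordan's lemma.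
\<close>
lemma primitive_increment_exp_decay:
  fixes H h :: "complex \<Rightarrow> complex"
  assumes H: "\<And>z. (H has_field_derivative h z) (at z)"
    and "norm w = 1" "c > 0" "l \<ge> 0" "B \<ge> 0"
    and bd: "\<And>r. 0 \<le> r \<Longrightarrow> r \<le> l \<Longrightarrow> norm (h (p + of_real r * w)) \<le> B * exp (- c * r)"
  shows "norm (H (p + of_real l * w) - H p) \<le> B / c"
proof (cases "l = 0")
  case True
  then show ?thesis using assms by simp
next
  case False
  have der: "((\<lambda>r. H (p + of_real r * w)) has_vector_derivative w * h (p + of_real r * w)) (at r)" for r
  proof -
    have "((\<lambda>u. H (p + u * w)) has_field_derivative h (p + of_real r * w) * w) (at (of_real r))"
      by (rule DERIV_chain2[OF H]) (auto intro!: derivative_eq_intros)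
    from has_vector_derivative_real_field[OF this] show ?thesis by (simp add: mult.commute)
  qed
  have der2: "((\<lambda>r. - (B / c) * exp (- c * r)) has_vector_derivative B * exp (- c * r)) (at r)" for r :: real
    unfolding has_real_derivative_iff_has_vector_derivative[symmetric]
    using \<open>c > 0\<close> by (auto intro!: derivative_eq_intros)
  have "norm (H (p + of_real l * w) - H (p + of_real 0 * w))
      \<le> - (B / c) * exp (- c * l) - - (B / c) * exp (- c * 0)"
  proof (rule differentiable_bound_general[OF _ _ _ der der2])
    show "0 < l" using False \<open>l \<ge> 0\<close> by simp
    show "continuous_on {0..l} (\<lambda>r. H (p + of_real r * w))"
      by (rule continuous_on_vector_derivative[OF has_vector_derivative_at_within[OF der]])
    show "continuous_on {0..l} (\<lambda>r. - (B / c) * exp (- c * r))"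
      by (intro continuous_intros)
    show "norm (w * h (p + of_real r * w)) \<le> B * exp (- c * r)" if "0 < r" "r < l" for r
      using bd[of r] that \<open>norm w = 1\<close> by (simp add: norm_mult)
  qed
  also have "\<dots> \<le> B / c"
    using \<open>c > 0\<close> \<open>B \<ge> 0\<close> by simp
  finally show ?thesis by simp
qed

lemma Im_cube: "Im (z ^ 3) = Im z * (3 * (Re z)\<^sup>2 - (Im z)\<^sup>2)"
  by (simp add: power3_eq_cube power2_eq_square algebra_simps)

text \<open>
  An entire function has a primitive \<open>H\<close>, so both truncated contour integrals depend only on the values of \<open>H\<close>
  at the endpoints \<open>\<plusminus> N\<close>, \<open>N w\<close> and \<open>N v\<close>, where \<open>w\<close> and \<open>v\<close> are the directions of the two
  rays. Along the rays \<open>H\<close> converges, since its derivative decays exponentially. The endpoints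
  \<open>N\<close> and \<open>N w\<close> (likewise \<open>-N\<close> and \<open>N v\<close>) are joined by a chord on which \<open>g\<close> is
  \<open>O(1/N)\<close> and \<open>e\<^sup>i\<^sup>z\<^sup>x\<close> decays exponentially in the distance from the real axis, so the values
  of \<open>H\<close> at these endpoints have the same limit.
\<close>
lemma real_line_and_sector_boundary_integrals:
  fixes g :: "complex \<Rightarrow> complex"
  assumes hol: "g holomorphic_on UNIV" and x: "x > 0" and "C \<ge> 0"
    and decay: "\<And>z. Im z \<ge> 0 \<Longrightarrow> Im (z ^ 3) \<ge> 0 \<Longrightarrow> norm z \<ge> 1 \<Longrightarrow> norm (g z) \<le> C / norm z"
  defines "h \<equiv> \<lambda>z. exp (\<i> * z * of_real x) * g z"
  obtains I where
    "((\<lambda>N. integral {-N..N} (\<lambda>r. h (of_real r))) \<longlongrightarrow> I) at_top"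
    "((\<lambda>N. contour_integral (bdry_path N) h) \<longlongrightarrow> I) at_top"
proof -
  define w where "w = cis (pi / 3)"
  define v where "v = cis (2 * pi / 3)"
  define c where "c = sqrt 3 / 2"
  have c: "c > 0" and c2: "c\<^sup>2 = 3 / 4" by (simp_all add: c_def power_divide)
  have w: "Re w = 1/2" "Im w = c" "norm w = 1" by (simp_all add: w_def c_def cos_60 sin_60)
  have v: "Re v = -1/2" "Im v = c" "norm v = 1" by (simp_all add: v_def c_def cos_120 sin_120)
  have cx: "c * x > 0" using c x by simp
  have holh: "h holomorphic_on UNIV"
    unfolding h_def by (intro holomorphic_intros hol)
  then obtain H where H: "\<And>z. (H has_field_derivative h z) (at z)"
    using holomorphic_convex_primitive'[OF convex_UNIV open_UNIV] by auto
  have normh: "norm (h z) = exp (- (x * Im z)) * norm (g z)" for z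
    by (simp add: h_def norm_mult mult.commute)
  have bdry: "contour_integral (bdry_path N) h = H (of_real N * w) - H (of_real N * v)" for N
  proof -
    have "(h has_contour_integral (H (pathfinish (bdry_path N)) - H (pathstart (bdry_path N)))) (bdry_path N)"
      by (rule contour_integral_primitive[of UNIV]) (use H in \<open>auto simp: bdry_path_def\<close>)
    then show ?thesis
      by (simp add: bdry_path_def w_def v_def contour_integral_unique)
  qed
  have line: "integral {-N..N} (\<lambda>r. h (of_real r)) = H (of_real N) - H (- of_real N)" if "N > 0" for N
  proof -
    have "(h has_contour_integral (H (pathfinish (linepath (- of_real N) (of_real N)))
        - H (pathstart (linepath (- of_real N) (of_real N))))) (linepath (- of_real N) (of_real N))"
      by (rule contour_integral_primitive[of UNIV]) (use H in auto)
    then show ?thesis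
      using that by (subst (asm) has_contour_integral_linepath_Reals_iff) (auto intro: integral_unique)
  qed
  (* The points 0, N and N w form an equilateral triangle, so its third side runs from N in the
     direction v; the reflection in the imaginary axis exchanges the roles of w and v. *)
  have chords: "((\<lambda>N. H (of_real N * u) - H (of_real (s * N))) \<longlongrightarrow> 0) at_top"
    if us: "(s = 1 \<and> u = w \<and> d = v) \<or> (s = -1 \<and> u = v \<and> d = w)" for s :: real and u d
  proof (rule Lim_null_comparison)
    have u: "Re u = s / 2" "Im u = c" and d: "Re d = - s / 2" "Im d = c" "norm d = 1"
      and s: "s = 1 \<or> s = -1"
      using us by (elim disjE conjE; simp add: w v)+
    show "((\<lambda>N. (2 * C / N) / (c * x)) \<longlongrightarrow> 0) at_top"
      by (intro tendsto_divide_zero tendsto_divide_0[OF tendsto_const]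
          filterlim_at_top_imp_at_infinity filterlim_ident)
    show "\<forall>\<^sub>F N in at_top. norm (H (of_real N * u) - H (of_real (s * N))) \<le> (2 * C / N) / (c * x)"
      using eventually_ge_at_top[of 2]
    proof eventually_elim
      case (elim N)
      have eq: "of_real N * u = of_real (s * N) + of_real N * d"
        by (simp add: complex_eq_iff u d)
      show ?case unfolding eq
      proof (rule primitive_increment_exp_decay[OF H _ cx])
        show "norm d = 1" by (rule d)
        show "N \<ge> 0" "2 * C / N \<ge> 0" using elim \<open>C \<ge> 0\<close> by auto
        fix r assume r: "0 \<le> r" "r \<le> N"
        define z where "z = of_real (s * N) + of_real r * d"
        have Imz: "Im z = r * c" by (simp add: z_def d)
        have Rez: "\<bar>Re z\<bar> = N - r / 2" using s r by (auto simp: z_def d)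
        (* As r \<le> N, the real part is at least N/2: the chord stays at distance N/2 from 0, and within the
           sectors between the two contours, where the decay hypothesis applies. *)
        have nz: "norm z \<ge> N / 2" using abs_Re_le_cmod[of z] Rez r by linarith
        have "(Im z)\<^sup>2 = 3 * (r/2)\<^sup>2" by (simp add: Imz power_mult_distrib c2 power_divide)
        also have "(r/2)\<^sup>2 \<le> \<bar>Re z\<bar>\<^sup>2" using r by (intro power_mono) (auto simp: Rez)
        finally have "Im (z ^ 3) \<ge> 0"
          unfolding Im_cube using Imz r c by (intro mult_nonneg_nonneg) auto
        then have "norm (g z) \<le> C / norm z"
          using Imz r c nz elim by (intro decay) auto
        also have "\<dots> \<le> C / (N / 2)"
          using nz elim \<open>C \<ge> 0\<close> by (intro divide_left_mono mult_pos_pos) auto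
        finally have "norm (g z) \<le> 2 * C / N" by (simp add: field_simps)
        then have "exp (- (x * Im z)) * norm (g z) \<le> exp (- (x * Im z)) * (2 * C / N)"
          by (intro mult_left_mono) auto
        then show "norm (h (of_real (s * N) + of_real r * d)) \<le> 2 * C / N * exp (- (c * x) * r)"
          unfolding z_def[symmetric] normh Imz by (simp add: mult_ac)
      qed
    qed
  qed
  obtain K where K: "\<And>z. norm z \<le> 1 \<Longrightarrow> norm (g z) \<le> K"
  proof -
    have "bounded (g ` cball 0 1)"
      using hol by (intro compact_imp_bounded compact_continuous_image holomorphic_on_imp_continuous_on)
        (auto intro: holomorphic_on_subset)
    then obtain K where "\<forall>z\<in>cball 0 1. norm (g z) \<le> K"
      unfolding bounded_iff by blast
    then show ?thesis by (intro that[of K]) simp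
  qed
  have rays: "\<exists>L. ((\<lambda>r. H (of_real r * u)) \<longlongrightarrow> L) at_top" if u: "u = w \<or> u = v" for u
  proof -
    have nu: "norm u = 1" and Imu: "Im u = c" and Reu: "(Re u)\<^sup>2 = 1/4"
      using u by (auto simp: power2_eq_square w v)
    (* On the rays the cube of z is real, so the condition Im (z ^ 3) \<ge> 0 holds with equality. *)
    define k where "k r = u * h (of_real r * u)" for r :: real
    have bound: "norm (k r) \<le> (K + C) * exp (- (c * x) * r)" if "r \<ge> 0" for r
    proof -
      have "K \<ge> 0" using order_trans[OF norm_ge_zero K[of 0]] by simp
      have "norm (g (of_real r * u)) \<le> K + C"
      proof (cases "r \<le> 1")
        case True
        then show ?thesis using K[of "of_real r * u"] that nu \<open>C \<ge> 0\<close> by (simp add: norm_mult)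
      next
        case False
        have "Im ((of_real r * u) ^ 3) = 0"
          by (simp add: Im_cube Imu Reu power_mult_distrib c2)
        then have "norm (g (of_real r * u)) \<le> C / norm (of_real r * u)"
          using False c Imu nu by (intro decay) (auto simp: norm_mult)
        also have "\<dots> \<le> C"
          using False nu \<open>C \<ge> 0\<close> mult_left_mono[of 1 r C] by (simp add: norm_mult field_simps)
        finally show ?thesis using \<open>K \<ge> 0\<close> by simp
      qed
      then have "exp (- (x * (r * c))) * norm (g (of_real r * u)) \<le> exp (- (x * (r * c))) * (K + C)"
        by (intro mult_left_mono) auto
      then show ?thesis by (simp add: k_def norm_mult nu normh Imu mult_ac)
    qed
    have "continuous_on {0..} k"
    proof -
      have "continuous_on UNIV h" using holh by (rule holomorphic_on_imp_continuous_on)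
      then show ?thesis unfolding k_def
        by (intro continuous_intros continuous_on_compose2[where f = "\<lambda>r. of_real r * u" and g = h]) auto
    qed
    moreover have "(\<lambda>r. (K + C) * exp (- (c * x) * r)) integrable_on {0..}"
      by (rule integrable_on_mult_right[OF integrable_on_exp_minus_to_infinity[OF cx]])
    ultimately have "k absolutely_integrable_on {0..}"
      by (rule absolutely_integrable_half_line_bound) (rule bound)
    moreover have "((\<lambda>r. H (of_real r * u)) has_vector_derivative k r) (at r within {0..})" for r
    proof -
      have "((\<lambda>z. H (z * u)) has_field_derivative h (of_real r * u) * u) (at (of_real r))"
        by (rule DERIV_chain2[OF H]) (auto intro!: derivative_eq_intros)
      from has_vector_derivative_real_field[OF this] show ?thesis
        by (rule has_vector_derivative_at_within[THEN has_vector_derivative_eq_rhs])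
           (simp_all add: k_def mult.commute)
    qed
    ultimately show ?thesis using half_line_FTC by blast
  qed
  obtain P Q where PQ: "((\<lambda>r. H (of_real r * w)) \<longlongrightarrow> P) at_top" "((\<lambda>r. H (of_real r * v)) \<longlongrightarrow> Q) at_top"
    using rays by blast
  show ?thesis
  proof (rule that)
    show "((\<lambda>N. contour_integral (bdry_path N) h) \<longlongrightarrow> P - Q) at_top"
      unfolding bdry by (intro tendsto_diff PQ)
    have "((\<lambda>N. (H (of_real N * w) - (H (of_real N * w) - H (of_real (1 * N))))
        - (H (of_real N * v) - (H (of_real N * v) - H (of_real (-1 * N))))) \<longlongrightarrow> (P - 0) - (Q - 0)) at_top"
      by (intro tendsto_diff PQ chords) auto
    then have "((\<lambda>N. H (of_real N) - H (- of_real N)) \<longlongrightarrow> P - Q) at_top" by simp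
    moreover have "\<forall>\<^sub>F N in at_top. integral {-N..N} (\<lambda>r. h (of_real r)) = H (of_real N) - H (- of_real N)"
      using eventually_gt_at_top[of 0] by eventually_elim (rule line)
    ultimately show "((\<lambda>N. integral {-N..N} (\<lambda>r. h (of_real r))) \<longlongrightarrow> P - Q) at_top"
      using tendsto_cong by fast
  qed
qed

section \<open>Decay of the time integrals\<close>

text \<open>
  Integration by parts against \<open>E(s) = e\<^sup>-\<^sup>i\<^sup>w\<^sup>(\<^sup>s\<^sup>-\<^sup>t\<^sup>)\<close>, whose modulus is at most 1 for \<open>s \<le> t\<close> and
  \<open>Im w \<ge> 0\<close>. The constant does not depend on \<open>w\<close>.
\<close>
lemma oscillatory_integral_bound:
  fixes a a' :: "real \<Rightarrow> complex"
  assumes "t \<ge> 0"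
    and a: "\<And>s. s \<in> {0..t} \<Longrightarrow> (a has_vector_derivative a' s) (at s within {0..t})"
    and a': "continuous_on {0..t} a'"
  obtains C where "C \<ge> 0"
    "\<And>w. w \<noteq> 0 \<Longrightarrow> Im w \<ge> 0 \<Longrightarrow>
       norm (integral {0..t} (\<lambda>s. exp (- \<i> * w * of_real (s - t)) * a s)) \<le> C / norm w"
proof -
  obtain M where M: "\<And>s. s \<in> {0..t} \<Longrightarrow> norm (a' s) \<le> M"
    using compact_imp_bounded[OF compact_continuous_image[OF a' compact_Icc]]
    unfolding bounded_iff by blast
  have M0: "M \<ge> 0" using order_trans[OF norm_ge_zero M[of 0]] \<open>t \<ge> 0\<close> by simp
  have ca: "continuous_on {0..t} a"
    using a by (rule continuous_on_vector_derivative)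
  show ?thesis
  proof (rule that[of "norm (a t) + norm (a 0) + M * t"])
    show "0 \<le> norm (a t) + norm (a 0) + M * t" using M0 \<open>t \<ge> 0\<close> by simp
    fix w :: complex assume w: "w \<noteq> 0" "Im w \<ge> 0"
    define E where "E s = exp (- \<i> * w * of_real (s - t))" for s
    have cE: "continuous_on {0..t} E" unfolding E_def by (intro continuous_intros)
    have nE: "norm (E s) \<le> 1" if "s \<in> {0..t}" for s
      using that w by (simp add: E_def mult_nonneg_nonpos)
    have dE: "(E has_vector_derivative - \<i> * w * E s) (at s within {0..t})" for s
    proof -
      have "((\<lambda>s. exp (- \<i> * w * (s - of_real t))) has_field_derivative - \<i> * w * E s) (at (of_real s))"
        by (auto intro!: derivative_eq_intros simp: E_def)
      from has_vector_derivative_real_field[OF this, unfolded E_def of_real_diff]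
      show ?thesis unfolding E_def of_real_diff by (rule has_vector_derivative_at_within)
    qed
    have i1: "(\<lambda>s. E s * a s) integrable_on {0..t}" and i2: "(\<lambda>s. E s * a' s) integrable_on {0..t}"
      by (intro integrable_continuous_interval continuous_intros cE ca a')+
    have "((\<lambda>s. E s * a' s + - \<i> * w * E s * a s) has_integral E t * a t - E 0 * a 0) {0..t}"
      by (rule fundamental_theorem_of_calculus[OF \<open>t \<ge> 0\<close>]) (intro has_vector_derivative_mult dE a)
    then have "integral {0..t} (\<lambda>s. E s * a' s + (- \<i> * w) * (E s * a s)) = E t * a t - E 0 * a 0"
      by (intro integral_unique) (simp add: mult_ac)
    then have "integral {0..t} (\<lambda>s. E s * a' s) + (- \<i> * w) * integral {0..t} (\<lambda>s. E s * a s)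
        = E t * a t - E 0 * a 0"
      by (simp only: integral_add[OF i2 integrable_on_mult_right[OF i1]] integral_mult_right)
    then have "\<i> * w * integral {0..t} (\<lambda>s. E s * a s)
        = integral {0..t} (\<lambda>s. E s * a' s) + E 0 * a 0 - E t * a t"
      by (simp add: algebra_simps)
    then have "norm w * norm (integral {0..t} (\<lambda>s. E s * a s))
        = norm (integral {0..t} (\<lambda>s. E s * a' s) + E 0 * a 0 - E t * a t)"
      by (metis norm_mult norm_ii mult_1)
    also have "\<dots> \<le> norm (integral {0..t} (\<lambda>s. E s * a' s)) + norm (E 0 * a 0) + norm (E t * a t)"
      by (meson norm_triangle_ineq norm_triangle_ineq4 add_mono order_refl order_trans)
    also have "\<dots> \<le> M * t + norm (a 0) + norm (a t)"
    proof (intro add_mono)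
      have "norm (E s * a' s) \<le> M" if "s \<in> {0..t}" for s
        using mult_mono[OF nE[OF that] M[OF that]] by (simp add: norm_mult)
      then show "norm (integral {0..t} (\<lambda>s. E s * a' s)) \<le> M * t"
        using integral_bound[OF \<open>t \<ge> 0\<close>, of "\<lambda>s. E s * a' s" M] cE a'
        by (auto intro: continuous_intros)
      show "norm (E 0 * a 0) \<le> norm (a 0)" "norm (E t * a t) \<le> norm (a t)"
        using nE[of 0] nE[of t] \<open>t \<ge> 0\<close> by (auto simp: norm_mult intro: mult_left_le_one_le)
    qed
    finally show "norm (integral {0..t} (\<lambda>s. exp (- \<i> * w * of_real (s - t)) * a s))
        \<le> (norm (a t) + norm (a 0) + M * t) / norm w"
      using w by (simp add: E_def field_simps)
  qed
qed

lemma time_integral_holomorphic: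
  fixes a b :: "real \<Rightarrow> complex"
  assumes "continuous_on {0..t} a" "continuous_on {0..t} b"
  shows "(\<lambda>z. integral {0..t} (\<lambda>s. exp (- \<i> * z ^ 3 * of_real (s - t)) * (z\<^sup>2 * a s - b s)))
    holomorphic_on UNIV"
proof -
  define f where "f z s = exp (- \<i> * z ^ 3 * of_real (s - t)) * (z\<^sup>2 * a s - b s)" for z s
  define f' where "f' z s = exp (- \<i> * z ^ 3 * of_real (s - t)) * (2 * z * a s)
    + exp (- \<i> * z ^ 3 * of_real (s - t)) * (- \<i> * (3 * z\<^sup>2) * of_real (s - t)) * (z\<^sup>2 * a s - b s)" for z s
  have "(\<lambda>z. integral (cbox 0 t) (f z)) holomorphic_on UNIV"
  proof (rule leibniz_rule_holomorphic)
    show "((\<lambda>z. f z s) has_field_derivative f' z s) (at z within UNIV)" for z s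
      unfolding f_def f'_def by (auto intro!: derivative_eq_intros simp: algebra_simps)
    show "f z integrable_on cbox 0 t" for z
      unfolding f_def using assms
      by (auto intro!: integrable_continuous_interval continuous_intros)
    have "continuous_on (UNIV \<times> {0..t}) (\<lambda>p. a (snd p))" "continuous_on (UNIV \<times> {0..t}) (\<lambda>p. b (snd p))"
      by (rule continuous_on_compose2[OF assms(1) continuous_on_snd[OF continuous_on_id]],
          force, rule continuous_on_compose2[OF assms(2) continuous_on_snd[OF continuous_on_id]], force)
    then show "continuous_on (UNIV \<times> cbox 0 t) (\<lambda>(z, s). f' z s)"
      unfolding f'_def case_prod_beta cbox_interval by (intro continuous_intros)
  qed auto
  then show ?thesis unfolding f_def cbox_interval .
qed

text \<open>
  The factor \<open>z\<^sup>2\<close> costs two of the three powers gained from \<open>w = z\<^sup>3\<close> in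
  \<open>oscillatory_integral_bound\<close>, which leaves \<open>1/|z|\<close>.
\<close>
lemma time_integral_decay:
  fixes a b a' b' :: "real \<Rightarrow> complex"
  assumes "t \<ge> 0"
    and a: "\<And>s. s \<in> {0..t} \<Longrightarrow> (a has_vector_derivative a' s) (at s within {0..t})"
    and b: "\<And>s. s \<in> {0..t} \<Longrightarrow> (b has_vector_derivative b' s) (at s within {0..t})"
    and cont: "continuous_on {0..t} a'" "continuous_on {0..t} b'"
  obtains C where "C \<ge> 0"
    "\<And>z. Im (z ^ 3) \<ge> 0 \<Longrightarrow> norm z \<ge> 1 \<Longrightarrow>
       norm (integral {0..t} (\<lambda>s. exp (- \<i> * z ^ 3 * of_real (s - t)) * (z\<^sup>2 * a s - b s))) \<le> C / norm z"
proof -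
  have ca: "continuous_on {0..t} a" and cb: "continuous_on {0..t} b"
    by (rule continuous_on_vector_derivative[OF a], assumption,
        rule continuous_on_vector_derivative[OF b], assumption)
  obtain A where A: "A \<ge> 0" "\<And>w. w \<noteq> 0 \<Longrightarrow> Im w \<ge> 0 \<Longrightarrow>
       norm (integral {0..t} (\<lambda>s. exp (- \<i> * w * of_real (s - t)) * a s)) \<le> A / norm w"
    using oscillatory_integral_bound[OF \<open>t \<ge> 0\<close> a cont(1)] by blast
  obtain B where B: "B \<ge> 0" "\<And>w. w \<noteq> 0 \<Longrightarrow> Im w \<ge> 0 \<Longrightarrow>
       norm (integral {0..t} (\<lambda>s. exp (- \<i> * w * of_real (s - t)) * b s)) \<le> B / norm w"
    using oscillatory_integral_bound[OF \<open>t \<ge> 0\<close> b cont(2)] by blast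
  show ?thesis
  proof (rule that[of "A + B"])
    show "A + B \<ge> 0" using A B by simp
    fix z :: complex assume z: "Im (z ^ 3) \<ge> 0" "norm z \<ge> 1"
    define P where "P = integral {0..t} (\<lambda>s. exp (- \<i> * z ^ 3 * of_real (s - t)) * a s)"
    define Q where "Q = integral {0..t} (\<lambda>s. exp (- \<i> * z ^ 3 * of_real (s - t)) * b s)"
    have z0: "z ^ 3 \<noteq> 0" using z by auto
    have P: "norm P \<le> A / norm z ^ 3" and Q: "norm Q \<le> B / norm z ^ 3"
      using A(2)[OF z0 z(1)] B(2)[OF z0 z(1)] by (simp_all add: P_def Q_def norm_power)
    have "integral {0..t} (\<lambda>s. exp (- \<i> * z ^ 3 * of_real (s - t)) * (z\<^sup>2 * a s - b s))
        = integral {0..t} (\<lambda>s. z\<^sup>2 * (exp (- \<i> * z ^ 3 * of_real (s - t)) * a s)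
            - exp (- \<i> * z ^ 3 * of_real (s - t)) * b s)"
      by (simp add: algebra_simps)
    also have "\<dots> = z\<^sup>2 * P - Q"
      unfolding P_def Q_def using ca cb
      by (subst integral_diff)
         (auto intro!: integrable_continuous_interval continuous_intros)
    also have "norm \<dots> \<le> norm z ^ 2 * norm P + norm Q"
      by (metis norm_mult norm_power norm_triangle_ineq4)
    also have "\<dots> \<le> norm z ^ 2 * (A / norm z ^ 3) + norm z ^ 2 * (B / norm z ^ 3)"
    proof (intro add_mono mult_left_mono P)
      have "norm Q \<le> 1 * (B / norm z ^ 3)" using Q by simp
      also have "\<dots> \<le> norm z ^ 2 * (B / norm z ^ 3)"
        using z B(1) by (intro mult_right_mono) (auto simp: one_le_power)
      finally show "norm Q \<le> norm z ^ 2 * (B / norm z ^ 3)" .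
    qed auto
    also have "\<dots> = (A + B) / norm z"
      using z by (auto simp: field_simps eval_nat_numeral)
    finally show "norm (integral {0..t} (\<lambda>s. exp (- \<i> * z ^ 3 * of_real (s - t)) * (z\<^sup>2 * a s - b s)))
        \<le> (A + B) / norm z" .
  qed
qed

lemma sufficiently_smooth_boundary_values:
  assumes q: "sufficiently_smooth T q" and t: "t \<in> {0..T}" and "j \<le> 2"
  obtains a' where
    "\<And>s. s \<in> {0..t} \<Longrightarrow> (partial_x j q 0 has_vector_derivative a' s) (at s within {0..t})"
    "continuous_on {0..t} a'"
proof
  let ?a' = "\<lambda>s. vector_derivative (partial_x j q 0) (at s within {0..T})"
  show "(partial_x j q 0 has_vector_derivative ?a' s) (at s within {0..t})" if "s \<in> {0..t}" for s
  proof (rule has_vector_derivative_within_subset)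
    show "(partial_x j q 0 has_vector_derivative ?a' s) (at s within {0..T})"
      using q that t \<open>j \<le> 2\<close> by (auto simp: sufficiently_smooth_def vector_derivative_works)
  qed (use t in auto)
  have "continuous_on ({0..} \<times> {0..T})
      (\<lambda>(x, t). vector_derivative (\<lambda>s. partial_x j q x s) (at t within {0..T}))"
    using q \<open>j \<le> 2\<close> by (auto simp: sufficiently_smooth_def)
  then have "continuous_on {0..t} (\<lambda>s. case (0, s) of (x, t) \<Rightarrow>
      vector_derivative (\<lambda>s. partial_x j q x s) (at t within {0..T}))"
    by (rule continuous_on_compose2) (use t in \<open>auto intro!: continuous_intros\<close>)
  then show "continuous_on {0..t} ?a'" by simp
qed

section \<open>Vanishing of the inverse transform\<close>

text \<open>
  The two parts of the transform are \<open>I\<close> and \<open>- I\<close>, because the remainder changes sign between the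
  contours while the integrals of \<open>h\<close> over both contours have the same limit \<open>I\<close>.
\<close>
lemma F_inv_remainder:
  assumes q: "sufficiently_smooth T q" and t: "t \<in> {0..T}" and x: "x > 0"
  shows "has_F_inv (\<lambda>l. integral {0..t} (\<lambda>s. exp (- \<i> * pt l ^ 3 * of_real (s - t))
           * remainder (\<lambda>y. q y s) l)) x 0"
proof -
  define a where "a = partial_x 0 q 0"
  define b where "b = partial_x 2 q 0"
  define g where "g z = integral {0..t} (\<lambda>s. exp (- \<i> * z ^ 3 * of_real (s - t)) * (z\<^sup>2 * a s - b s))" for z
  have t0: "t \<ge> 0" using t by simp
  obtain a' where a': "\<And>s. s \<in> {0..t} \<Longrightarrow> (a has_vector_derivative a' s) (at s within {0..t})"
      "continuous_on {0..t} a'"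
    using sufficiently_smooth_boundary_values[OF q t, of 0] by (auto simp: a_def)
  obtain b' where b': "\<And>s. s \<in> {0..t} \<Longrightarrow> (b has_vector_derivative b' s) (at s within {0..t})"
      "continuous_on {0..t} b'"
    using sufficiently_smooth_boundary_values[OF q t, of 2] by (auto simp: b_def)
  have hol: "g holomorphic_on UNIV"
    unfolding g_def
    by (rule time_integral_holomorphic[OF
        continuous_on_vector_derivative[OF a'(1)] continuous_on_vector_derivative[OF b'(1)]])
  obtain C where C: "C \<ge> 0" "\<And>z. Im (z ^ 3) \<ge> 0 \<Longrightarrow> norm z \<ge> 1 \<Longrightarrow> norm (g z) \<le> C / norm z"
    using time_integral_decay[OF t0 a'(1) b'(1) a'(2) b'(2)] unfolding g_def by blast
  define h where "h z = exp (\<i> * z * of_real x) * g z" for z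
  have holh: "h holomorphic_on UNIV"
    unfolding h_def by (intro holomorphic_intros hol)
  obtain I where I: "((\<lambda>N. integral {-N..N} (\<lambda>r. h (of_real r))) \<longlongrightarrow> I) at_top"
    "((\<lambda>N. contour_integral (bdry_path N) h) \<longlongrightarrow> I) at_top"
    using real_line_and_sector_boundary_integrals[OF hol x C] unfolding h_def by blast
  define f where "f l = integral {0..t} (\<lambda>s. exp (- \<i> * pt l ^ 3 * of_real (s - t))
           * remainder (\<lambda>y. q y s) l)" for l
  have fR: "f (On_R r) = g (of_real r)" for r
    by (simp add: f_def g_def a_def b_def partial_x_def)
  have fD: "f (On_D z) = - g z" for z
  proof -
    have "f (On_D z) = integral {0..t} (\<lambda>s. - (exp (- \<i> * z ^ 3 * of_real (s - t)) * (z\<^sup>2 * a s - b s)))"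
      by (simp add: f_def a_def b_def partial_x_def algebra_simps)
    also have "\<dots> = - g z" unfolding g_def by (rule integral_neg)
    finally show ?thesis .
  qed
  have ci: "h contour_integrable_on bdry_path N" for N
    by (rule contour_integrable_holomorphic_simple[OF holh open_UNIV]) (auto simp: bdry_path_def)
  have "has_F_inv f x 0"
    unfolding has_F_inv_def
  proof (intro exI conjI allI impI)
    show "(\<lambda>r. exp (\<i> * of_real r * of_real x) * f (On_R r)) integrable_on {-N..N}" for N
    proof -
      have "continuous_on {-N..N} (\<lambda>r. h (of_real r))"
        by (rule continuous_on_compose2[OF holomorphic_on_imp_continuous_on[OF holh]])
           (auto intro: continuous_intros)
      then show ?thesis by (simp add: fR h_def integrable_continuous_interval)
    qed
    show "((\<lambda>N. integral {-N..N} (\<lambda>r. exp (\<i> * of_real r * of_real x) * f (On_R r))) \<longlongrightarrow> I) at_top"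
      using I(1) by (simp add: fR h_def)
    have neg: "(\<lambda>z. exp (\<i> * z * of_real x) * f (On_D z)) = (\<lambda>z. - h z)"
      by (simp add: fD h_def)
    show "(\<lambda>z. exp (\<i> * z * of_real x) * f (On_D z)) contour_integrable_on bdry_path N" for N
      unfolding neg by (rule contour_integrable_neg[OF ci])
    show "((\<lambda>N. contour_integral (bdry_path N) (\<lambda>z. exp (\<i> * z * of_real x) * f (On_D z))) \<longlongrightarrow> - I) at_top"
      unfolding neg contour_integral_neg by (rule tendsto_minus[OF I(2)])
    show "0 = 1 / (2 * of_real pi) * I + 1 / (2 * of_real pi) * - I" by simp
  qed
  then show ?thesis unfolding f_def .
qed

theorem theorem4:
  fixes T :: real
  assumes "T > 0"
  shows "\<exists>R :: (real \<Rightarrow> complex) \<Rightarrow> contour_point \<Rightarrow> complex.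
    (\<forall>l\<in>contours. \<forall>\<phi>\<in>Dom_L. F (L_op \<phi>) l = - \<i> * pt l ^ 3 * F \<phi> l + R \<phi> l) \<and>
    (\<forall>q :: real \<Rightarrow> real \<Rightarrow> complex.
       sufficiently_smooth T q \<and> (\<forall>t\<in>{0..T}. (\<lambda>x. q x t) \<in> Dom_L) \<longrightarrow>
       (\<forall>t\<in>{0..T}. \<forall>x>0.
          has_F_inv (\<lambda>l. integral {0..t} (\<lambda>s. exp (- \<i> * pt l ^ 3 * of_real (s - t)) * R (\<lambda>y. q y s) l)) x 0))"
  by (rule exI[of _ remainder]) (use F_L_op F_inv_remainder in auto)

end
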